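(* For any finite set $A\subseteq\mathbb{Z}$ with $|A|\geq 5$, we have $$|A+4\cdot A|\geq 5|A|-6 .$$
   Context: For a finite set $A\subseteq\mathbb{Z}$, $4\cdot A=\{4a: a\in A\}$ and $A+4\cdot A=\{a+4b: a,b\in A\}$. *)

theory Defs
  imports Main "HOL-Library.Set_Algebras"
begin

end

theory Submission
  imports Defs
begin

text \<open>
  Write \<open>A\<^sub>r\<close> for the class of \<open>r\<close> modulo 4 in \<open>A\<close>, and \<open>X\<^sub>r = {x. 4 x + r \<in> A}\<close>. The elements of
  \<open>A + 4 \<cdot> A\<close> that are congruent to \<open>r\<close> form an affine copy of \<open>X\<^sub>r + A\<close>, so \<open>|A + 4 \<cdot> A|\<close> is the
  sum of \<open>|X\<^sub>r + A|\<close> over the classes that \<open>A\<close> occupies. Since translations and dilations change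
  nothing, \<open>A\<close> may be assumed to contain both parities (\<open>ex_both_parities\<close>). Then \<open>A\<close> occupies
  four classes, three classes, or two classes of different parity. Let \<open>n = |A|\<close>.

  With four classes, \<open>|X + A| \<ge> |X| + n - 1\<close> is enough. With three classes, the stronger estimate
  \<open>|X + A| \<ge> 2 |X| + n - 2\<close> holds (\<open>three_classes\<close>). To see this, divide \<open>X\<close> into classes modulo 4
  as well. Every class of \<open>X + A\<close> contains the sums of several pairs of classes of \<open>X\<close> and of \<open>A\<close>,
  and the largest of these sums counts. When the class sizes are tied, the minima
  (and maxima) of the competing sums cannot all coincide, and this gives the elements
  still missing.

  Let \<open>A\<close> have two classes \<open>P\<close> and \<open>Q\<close>, and let \<open>X\<close> be the quotient of \<open>P\<close>. If \<open>X\<close> occupies at least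
  three classes or two opposite ones, then counting as before is sufficient. Otherwise \<open>Q\<close> creates a
  class of \<open>X + A\<close> that \<open>X + P\<close> does not meet, so that \<open>|X + A| \<ge> |P + 4 \<cdot> P| + |Q|\<close>, and induction
  on \<open>n\<close> applies to \<open>P\<close>. The bound \<open>5 n - 6\<close> is false for some sets with 3 or 4 elements; hence the
  induction is run with the function \<open>dsz_bound\<close>, and for small \<open>P\<close> and \<open>Q\<close> the loss is
  compensated by single additional elements (\<open>two_classes_adjacent_gain\<close>, \<open>dsz_three_one\<close>).
\<close>

section \<open>Sumsets and residue classes modulo 4\<close>

abbreviation sz :: "int set \<Rightarrow> int"
  where "sz A \<equiv> int (card A)"

definition cls :: "int \<Rightarrow> int set \<Rightarrow> int set"
  where "cls r A = {a \<in> A. 4 dvd a - r}"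

text \<open>The preimage of the class of \<open>r\<close> under the map \<open>x \<mapsto> 4 x + r\<close>: a copy of
\<open>cls r A\<close> that is again a set of arbitrary integers, so that its own residues modulo 4 carry
information.\<close>

definition quot :: "int \<Rightarrow> int set \<Rightarrow> int set"
  where "quot r A = {x. 4 * x + r \<in> A}"

lemma sz_pos_iff: "finite A \<Longrightarrow> 0 < sz A \<longleftrightarrow> A \<noteq> {}"
  by (simp add: card_gt_0_iff)

lemma sz_ge_1: "finite A \<Longrightarrow> A \<noteq> {} \<Longrightarrow> 1 \<le> sz A"
  using sz_pos_iff[of A] by linarith

lemma sz_mono: "finite B \<Longrightarrow> A \<subseteq> B \<Longrightarrow> sz A \<le> sz B"
  by (simp add: card_mono)

text \<open>The chain \<open>Min A + b\<close> (\<open>b \<in> B\<close>) followed by \<open>a + Max B\<close> (\<open>a \<in> A\<close>) is increasing and its two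
parts share only \<open>Min A + Max B\<close>.\<close>

lemma sz_sumset:
  fixes A B :: "int set"
  assumes "finite A" "finite B" "A \<noteq> {}" "B \<noteq> {}"
  shows "sz A + sz B - 1 \<le> sz (A + B)"
proof -
  let ?L = "(+) (Min A) ` B" and ?R = "(\<lambda>a. a + Max B) ` A"
  have "?L \<inter> ?R \<subseteq> {Min A + Max B}"
  proof
    fix x assume "x \<in> ?L \<inter> ?R"
    then obtain a b where "b \<in> B" "x = Min A + b" "a \<in> A" "x = a + Max B" by auto
    moreover from this have "b \<le> Max B" "Min A \<le> a" using assms by auto
    ultimately show "x \<in> {Min A + Max B}" by auto
  qed
  then have "card (?L \<inter> ?R) \<le> 1"
    using card_mono[of "{Min A + Max B}" "?L \<inter> ?R"] by simp
  moreover have "card ?L = card B" "card ?R = card A"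
    by (auto intro!: card_image simp: inj_on_def)
  moreover have "card ?L + card ?R = card (?L \<union> ?R) + card (?L \<inter> ?R)"
    using assms by (intro card_Un_Int) auto
  moreover have "card (?L \<union> ?R) \<le> card (A + B)"
    using assms(1,2) Min_in[OF assms(1,3)] Max_in[OF assms(2,4)]
    by (intro card_mono finite_set_plus) (auto simp only: finite_UnI intro!: set_plus_intro)
  ultimately show ?thesis by linarith
qed

lemma sz_sumset_ge_right:
  fixes A B :: "int set"
  assumes "finite A" "finite B" "A \<noteq> {}"
  shows "sz B \<le> sz (A + B)"
  using sz_sumset[of A B] sz_ge_1[of A] assms by (cases "B = {}") auto

lemma sz_translate:
  fixes A :: "int set"
  shows "sz ({x} + A) = sz A"
proof -
  have "{x} + A = (+) x ` A" by (auto simp: set_plus_def)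
  then show ?thesis by (simp add: card_image)
qed

text \<open>If \<open>A\<close> reaches further to the left than its subset \<open>B\<close>, then \<open>Min X + Min A\<close> lies to the left of
all of \<open>X + B\<close>; likewise on the right. This supplies the last one or two elements
when the residue classes of \<open>A\<close> have equal sizes.\<close>

lemma sz_sumset_extreme:
  fixes X A B :: "int set"
  assumes fin: "finite X" "finite A" and ne: "X \<noteq> {}" "B \<noteq> {}" and "B \<subseteq> A"
  shows "sz (X + B) + of_bool (Min A < Min B) + of_bool (Max B < Max A) \<le> sz (X + A)"
proof -
  have finB: "finite B" and Ane: "A \<noteq> {}" using assms finite_subset by auto
  let ?lo = "Min X + Min A" and ?hi = "Max X + Max A"
  let ?L = "if Min A < Min B then {?lo} else {}" and ?H = "if Max B < Max A then {?hi} else {}"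
  have fXB: "finite (X + B)" using fin finB by (intro finite_set_plus)
  have lo: "?lo < y" if "y \<in> X + B" "Min A < Min B" for y
    using that fin finB by (auto elim!: set_plus_elim intro!: add_le_less_mono elim: less_le_trans)
  have hi: "y < ?hi" if "y \<in> X + B" "Max B < Max A" for y
    using that fin finB
    by (auto elim!: set_plus_elim intro!: add_le_less_mono intro: le_less_trans[OF Max_ge])
  obtain b x where "b \<in> B" "x \<in> X" using ne by auto
  then have mid: "x + b \<in> X + B" by auto
  have "card (?L \<union> ?H) = of_bool (Min A < Min B) + of_bool (Max B < Max A)"
    using lo[OF mid] hi[OF mid] by auto
  moreover have "card ((?L \<union> ?H) \<union> (X + B)) = card (?L \<union> ?H) + card (X + B)"
    using lo hi fXB by (intro card_Un_disjoint) (auto split: if_splits)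
  moreover have "(?L \<union> ?H) \<union> (X + B) \<subseteq> X + A"
    using set_plus_mono2[of X X B A] \<open>B \<subseteq> A\<close>
      set_plus_intro[OF Min_in[OF fin(1) ne(1)] Min_in[OF fin(2) Ane]]
      set_plus_intro[OF Max_in[OF fin(1) ne(1)] Max_in[OF fin(2) Ane]]
    by (simp only: Un_subset_iff) (simp only: subset_refl empty_subsetI insert_subset split: if_split, blast)
  then have "card ((?L \<union> ?H) \<union> (X + B)) \<le> card (X + A)"
    using fin by (intro card_mono finite_set_plus)
  ultimately have "card (X + B) + of_bool (Min A < Min B) + of_bool (Max B < Max A) \<le> card (X + A)"
    by linarith
  then have "int (card (X + B) + of_bool (Min A < Min B) + of_bool (Max B < Max A)) \<le> sz (X + A)"
    by (simp only: of_nat_le_iff)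
  then show ?thesis by (simp only: of_nat_add of_nat_of_bool)
qed

lemma finite_cls [simp]: "finite A \<Longrightarrow> finite (cls r A)"
  by (simp add: cls_def)

lemma cls_subset: "cls r A \<subseteq> A"
  by (auto simp: cls_def)

lemma cls_cong:
  assumes "4 dvd r - r'"
  shows "cls r A = cls r' A"
proof -
  have "4 dvd a - r \<longleftrightarrow> 4 dvd a - r'" for a
    using assms by presburger
  then show ?thesis by (simp add: cls_def)
qed

lemma cls_cls:
  "cls t (cls t A) = cls t A"
  by (auto simp: cls_def)

text \<open>For odd \<open>\<delta>\<close> the residues \<open>r, r + \<delta>, r + 2 \<delta>, r + 3 \<delta>\<close> run through all classes modulo 4.
Leaving \<open>\<delta>\<close> open treats \<open>A\<close> and its reflection \<open>-A\<close> at the same time.\<close>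

lemma sz_by_classes:
  assumes fin: "finite A" and "odd \<delta>"
  shows "sz A = sz (cls r A) + sz (cls (r + \<delta>) A) + sz (cls (r + 2 * \<delta>) A) + sz (cls (r + 3 * \<delta>) A)"
proof -
  obtain k where k: "\<delta> = 2 * k + 1" using \<open>odd \<delta>\<close> by (rule oddE)
  have A: "A = cls r A \<union> (cls (r + \<delta>) A \<union> (cls (r + 2 * \<delta>) A \<union> cls (r + 3 * \<delta>) A))"
    unfolding k cls_def by (auto; presburger)
  have "cls (r + 2 * \<delta>) A \<inter> cls (r + 3 * \<delta>) A = {}"
    unfolding k cls_def by (auto; presburger)
  moreover have "cls (r + \<delta>) A \<inter> (cls (r + 2 * \<delta>) A \<union> cls (r + 3 * \<delta>) A) = {}"
    unfolding k cls_def by (auto; presburger)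
  moreover have "cls r A \<inter> (cls (r + \<delta>) A \<union> (cls (r + 2 * \<delta>) A \<union> cls (r + 3 * \<delta>) A)) = {}"
    unfolding k cls_def by (auto; presburger)
  ultimately show ?thesis
    by (subst A) (simp add: card_Un_disjoint fin)
qed

lemma cls_sumset_subset:
  assumes "4 dvd s + t - r"
  shows "cls s X + cls t A \<subseteq> cls r (X + A)"
proof
  fix z assume "z \<in> cls s X + cls t A"
  then obtain x a where "z = x + a" "x \<in> X" "a \<in> A" "4 dvd x - s" "4 dvd a - t"
    by (auto simp: cls_def elim!: set_plus_elim)
  moreover from this have "4 dvd x + a - r" using assms by presburger
  ultimately show "z \<in> cls r (X + A)" by (auto simp: cls_def)
qed

lemma sz_cls_sumset:
  assumes "finite X" "finite A" "cls s X \<noteq> {}" "cls t A \<noteq> {}" "4 dvd s + t - r"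
  shows "sz (cls s X) + sz (cls t A) - 1 \<le> sz (cls r (X + A))"
proof -
  have "sz (cls s X + cls t A) \<le> sz (cls r (X + A))"
    using assms by (intro sz_mono finite_cls finite_set_plus cls_sumset_subset)
  with sz_sumset[of "cls s X" "cls t A"] assms show ?thesis by simp
qed

text \<open>Adding a set that lies in one class keeps the classes of \<open>X\<close> apart, so the loss of 1 in
\<open>sz_sumset\<close> occurs once per occupied class of \<open>X\<close>, but \<open>cls t A\<close> is also gained that often.\<close>

lemma sz_sumset_cls:
  fixes s t \<delta> :: int
  assumes fin: "finite X" "finite A" and "odd \<delta>" and ne: "cls t A \<noteq> {}"
  defines "y \<equiv> \<lambda>i. cls (s + i * \<delta>) X"
  shows "sz X + (sz (cls t A) - 1) * (of_bool (y 0 \<noteq> {}) + of_bool (y 1 \<noteq> {}) + of_bool (y 2 \<noteq> {})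
    + of_bool (y 3 \<noteq> {})) \<le> sz (X + cls t A)"
proof -
  let ?B = "cls t A"
  have *: "sz (y i) + (sz ?B - 1) * of_bool (y i \<noteq> {}) \<le> sz (cls ((s + t) + i * \<delta>) (X + ?B))" for i
    using sz_cls_sumset[of X ?B "s + i * \<delta>" t "(s + t) + i * \<delta>"] fin ne
    by (auto simp: y_def cls_cls algebra_simps)
  have "sz X = sz (y 0) + sz (y 1) + sz (y 2) + sz (y 3)"
    using sz_by_classes[OF fin(1) \<open>odd \<delta>\<close>, of s] by (simp add: y_def)
  moreover have "finite (X + ?B)" using fin by (intro finite_set_plus) auto
  note sz_by_classes[OF this \<open>odd \<delta>\<close>, of "s + t"]
  ultimately show ?thesis
    using *[of 0] *[of 1] *[of 2] *[of 3] by (simp add: algebra_simps)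
qed

text \<open>Up to rotation, these are the only nonempty subsets of the cyclic group of order 4.\<close>

lemma residue_pattern:
  assumes "X \<noteq> {}" and "odd \<delta>"
  obtains (one) s where "cls s X \<noteq> {}" "cls (s + \<delta>) X = {}" "cls (s + 2 * \<delta>) X = {}" "cls (s + 3 * \<delta>) X = {}"
    | (adjacent) s where "cls s X \<noteq> {}" "cls (s + \<delta>) X \<noteq> {}" "cls (s + 2 * \<delta>) X = {}" "cls (s + 3 * \<delta>) X = {}"
    | (opposite) s where "cls s X \<noteq> {}" "cls (s + \<delta>) X = {}" "cls (s + 2 * \<delta>) X \<noteq> {}" "cls (s + 3 * \<delta>) X = {}"
    | (three) s where "cls s X \<noteq> {}" "cls (s + \<delta>) X \<noteq> {}" "cls (s + 2 * \<delta>) X \<noteq> {}" "cls (s + 3 * \<delta>) X = {}"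
    | (all) "\<And>s. cls s X \<noteq> {}"
proof -
  obtain k where k: "\<delta> = 2 * k + 1" using \<open>odd \<delta>\<close> by (rule oddE)
  define Y where "Y i = (cls (i * \<delta>) X \<noteq> {})" for i
  have per: "Y (i + 4) = Y i" for i
    using cls_cong[of "(i + 4) * \<delta>" "i * \<delta>" X] by (simp add: Y_def algebra_simps)
  have Y: "cls (i * \<delta>) X = {} \<longleftrightarrow> \<not> Y i" "cls (i * \<delta> + \<delta>) X = {} \<longleftrightarrow> \<not> Y (i + 1)"
    "cls (i * \<delta> + 2 * \<delta>) X = {} \<longleftrightarrow> \<not> Y (i + 2)" "cls (i * \<delta> + 3 * \<delta>) X = {} \<longleftrightarrow> \<not> Y (i + 3)" for i
    by (auto simp: Y_def algebra_simps)
  have res: "\<exists>i \<in> {0, 1, 2, 3}. cls s X = cls (i * \<delta>) X" for s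
  proof -
    have "\<exists>i \<in> {0, 1, 2, 3}. 4 dvd s - i * \<delta>" unfolding k by simp presburger
    then show ?thesis using cls_cong by blast
  qed
  obtain x where "x \<in> X" using assms by auto
  then have "cls x X \<noteq> {}" by (auto simp: cls_def)
  with res[of x] have some: "Y 0 \<or> Y 1 \<or> Y 2 \<or> Y 3" unfolding Y_def by fastforce
  have Y456: "Y 4 = Y 0" "Y 5 = Y 1" "Y 6 = Y 2" using per[of 0] per[of 1] per[of 2] by auto
  show thesis
  proof (cases "Y 0 \<and> Y 1 \<and> Y 2 \<and> Y 3")
    case True
    then show thesis using res all unfolding Y_def by (metis empty_iff insert_iff)
  next
    case False
    with some Y456 have "\<exists>i \<in> {0, 1, 2, 3}. (Y i \<and> \<not> Y (i + 1) \<and> \<not> Y (i + 2) \<and> \<not> Y (i + 3))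
      \<or> (Y i \<and> Y (i + 1) \<and> \<not> Y (i + 2) \<and> \<not> Y (i + 3))
      \<or> (Y i \<and> \<not> Y (i + 1) \<and> Y (i + 2) \<and> \<not> Y (i + 3))
      \<or> (Y i \<and> Y (i + 1) \<and> Y (i + 2) \<and> \<not> Y (i + 3))"
      by simp argo
    then obtain i where "(Y i \<and> \<not> Y (i + 1) \<and> \<not> Y (i + 2) \<and> \<not> Y (i + 3))
      \<or> (Y i \<and> Y (i + 1) \<and> \<not> Y (i + 2) \<and> \<not> Y (i + 3))
      \<or> (Y i \<and> \<not> Y (i + 1) \<and> Y (i + 2) \<and> \<not> Y (i + 3))
      \<or> (Y i \<and> Y (i + 1) \<and> Y (i + 2) \<and> \<not> Y (i + 3))" by blast
    then show thesis
      using one[of "i * \<delta>"] adjacent[of "i * \<delta>"] opposite[of "i * \<delta>"] three[of "i * \<delta>"]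
      by (auto simp: Y)
  qed
qed

section \<open>Sizes of the residue classes of a sumset\<close>

text \<open>Numbering the classes cyclically from \<open>r\<close> in steps of \<open>\<delta>\<close> makes most of the following estimates
linear arithmetic in these sizes.\<close>

definition cnt :: "int \<Rightarrow> int \<Rightarrow> int set \<Rightarrow> int \<Rightarrow> int"
  where "cnt r \<delta> A i = sz (cls (r + i * \<delta>) A)"

lemma cnt_nonneg: "0 \<le> cnt r \<delta> A i"
  by (simp add: cnt_def)

lemma cnt_0: "cnt r \<delta> A 0 = sz (cls r A)"
  by (simp add: cnt_def)

lemma cnt_pos_iff: "finite A \<Longrightarrow> 0 < cnt r \<delta> A i \<longleftrightarrow> cls (r + i * \<delta>) A \<noteq> {}"
  by (simp only: cnt_def sz_pos_iff finite_cls)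

lemma cnt_total:
  "finite A \<Longrightarrow> odd \<delta> \<Longrightarrow> sz A = cnt r \<delta> A 0 + cnt r \<delta> A 1 + cnt r \<delta> A 2 + cnt r \<delta> A 3"
  using sz_by_classes[of A \<delta> r] by (simp add: cnt_def)

text \<open>Each class \<open>k\<close> of \<open>X + A\<close> is bounded below by every pair of classes \<open>i\<close> of \<open>X\<close> and \<open>j\<close> of
\<open>A\<close> with \<open>i + j \<equiv> k\<close>; the later estimates pick the best pair for each \<open>k\<close>.\<close>

lemma cnt_sumset:
  assumes "finite X" "finite A" "0 < cnt s \<delta> X i" "0 < cnt t \<delta> A j" "4 dvd i + j - k"
  shows "cnt s \<delta> X i + cnt t \<delta> A j - 1 \<le> cnt (s + t) \<delta> (X + A) k"
proof -
  have "(s + i * \<delta>) + (t + j * \<delta>) - (s + t + k * \<delta>) = (i + j - k) * \<delta>"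
    by (simp add: algebra_simps)
  then have "4 dvd (s + i * \<delta>) + (t + j * \<delta>) - (s + t + k * \<delta>)"
    using assms(5) by simp
  with sz_cls_sumset[of X A "s + i * \<delta>" "t + j * \<delta>" "s + t + k * \<delta>"] assms
  show ?thesis by (simp add: cnt_pos_iff) (simp add: cnt_def)
qed

lemma sz_sumset_cls_cnt:
  assumes "finite X" "finite A" "odd \<delta>" "0 < cnt t \<epsilon> A j"
  shows "sz X + (cnt t \<epsilon> A j - 1) * (of_bool (0 < cnt s \<delta> X 0) + of_bool (0 < cnt s \<delta> X 1)
    + of_bool (0 < cnt s \<delta> X 2) + of_bool (0 < cnt s \<delta> X 3)) \<le> sz (X + cls (t + j * \<epsilon>) A)"
  using sz_sumset_cls[of X A \<delta> "t + j * \<epsilon>" s] assms cnt_pos_iff[of A t \<epsilon> j]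
  unfolding cnt_pos_iff[OF assms(1)] by (simp add: cnt_def)

lemma cnt_pattern:
  assumes "finite X" "X \<noteq> {}" and "odd \<delta>"
  obtains (one) s where "0 < cnt s \<delta> X 0" "cnt s \<delta> X 1 = 0" "cnt s \<delta> X 2 = 0" "cnt s \<delta> X 3 = 0"
    | (adjacent) s where "0 < cnt s \<delta> X 0" "0 < cnt s \<delta> X 1" "cnt s \<delta> X 2 = 0" "cnt s \<delta> X 3 = 0"
    | (opposite) s where "0 < cnt s \<delta> X 0" "cnt s \<delta> X 1 = 0" "0 < cnt s \<delta> X 2" "cnt s \<delta> X 3 = 0"
    | (three) s where "0 < cnt s \<delta> X 0" "0 < cnt s \<delta> X 1" "0 < cnt s \<delta> X 2" "cnt s \<delta> X 3 = 0"
    | (all) "\<And>s i. 0 < cnt s \<delta> X i"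
proof -
  have z: "cnt s \<delta> X i = 0 \<longleftrightarrow> cls (s + i * \<delta>) X = {}" for s i
    using assms(1) by (simp add: cnt_def)
  note p = cnt_pos_iff[OF assms(1)]
  show thesis
    using residue_pattern[OF assms(2,3), of thesis] one adjacent opposite three all
    unfolding z p by simp
qed

section \<open>Adding a set that occupies two classes\<close>

text \<open>With exactly three classes in \<open>X\<close>, the larger class of \<open>A\<close> is added to all of them and the
smaller one fills the fourth class of the sum. With four classes, adding the larger class
alone suffices unless both have the same size; then the one that does not contain \<open>Min A\<close>
gives one more element.\<close>

lemma two_classes_spread:
  assumes fin: "finite X" "finite A" and \<delta>: "odd \<delta>"
    and X: "0 < cnt s \<delta> X 0" "0 < cnt s \<delta> X 1" "0 < cnt s \<delta> X 2"
    and A: "0 < cnt u \<delta> A 0" "0 < cnt u \<delta> A 1"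
  shows "sz X + 3 * max (cnt u \<delta> A 0) (cnt u \<delta> A 1) + min (cnt u \<delta> A 0) (cnt u \<delta> A 1) - 3 \<le> sz (X + A)"
proof -
  let ?y = "cnt s \<delta> X" and ?a = "cnt u \<delta> A" and ?z = "cnt (s + u) \<delta> (X + A)"
  have tot: "sz (X + A) = ?z 0 + ?z 1 + ?z 2 + ?z 3" "sz X = ?y 0 + ?y 1 + ?y 2 + ?y 3"
    by (rule cnt_total[OF finite_set_plus[OF fin] \<delta>]) (rule cnt_total[OF fin(1) \<delta>])
  note z = cnt_sumset[OF fin]
  show ?thesis
  proof (cases "?y 3 = 0")
    case True
    have "?y 0 + ?a 0 - 1 \<le> ?z 0" "?y 1 + ?a 0 - 1 \<le> ?z 1" "?y 2 + ?a 0 - 1 \<le> ?z 2"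
      "?y 0 + ?a 1 - 1 \<le> ?z 1" "?y 1 + ?a 1 - 1 \<le> ?z 2" "?y 2 + ?a 1 - 1 \<le> ?z 3"
      using X A by (intro z; simp)+
    with tot True X show ?thesis by linarith
  next
    case False
    then have y3: "0 < ?y 3" using cnt_nonneg[of s \<delta> X 3] by linarith
    define P Q where "P = cls (u + 0 * \<delta>) A" and "Q = cls (u + 1 * \<delta>) A"
    have PQ: "P \<noteq> {}" "Q \<noteq> {}" "P \<subseteq> A" "Q \<subseteq> A" "finite P" "finite Q"
      using A fin cls_subset unfolding cnt_pos_iff[OF fin(2)] P_def Q_def by auto
    have "X \<noteq> {}" using X fin by (auto simp: cnt_def cls_def)
    note ext = sz_sumset_extreme[OF fin this]
    (* X now occupies all four classes, and P, Q lie in different ones, so their minima differ. *)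
    have "sz X + 4 * (?a 0 - 1) \<le> sz (X + P)" "sz X + 4 * (?a 1 - 1) \<le> sz (X + Q)"
      using sz_sumset_cls_cnt[OF fin \<delta> A(1), of s] sz_sumset_cls_cnt[OF fin \<delta> A(2), of s] X y3
      unfolding P_def Q_def by simp_all
    with ext[OF PQ(1,3)] ext[OF PQ(2,4)]
    have b: "sz X + 4 * (?a 0 - 1) + of_bool (Min A < Min P) \<le> sz (X + A)"
      "sz X + 4 * (?a 1 - 1) + of_bool (Min A < Min Q) \<le> sz (X + A)"
      by (auto simp: of_bool_def split: if_splits)
    have "Min P \<in> P" "Min Q \<in> Q" using PQ by auto
    then have "4 dvd Min P - u" "4 dvd Min Q - (u + \<delta>)" by (auto simp: P_def Q_def cls_def)
    with \<delta> have "Min P \<noteq> Min Q" by presburger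
    moreover have "Min A \<le> Min P" "Min A \<le> Min Q" using PQ fin by (auto intro!: Min_antimono)
    ultimately have "Min A < Min P \<or> Min A < Min Q" by linarith
    with b show ?thesis by (auto simp: of_bool_def split: if_splits)
  qed
qed

text \<open>All four sums of a class of \<open>X\<close> and a class of \<open>A\<close> lie in different classes.\<close>

lemma two_classes_opposite:
  assumes fin: "finite X" "finite A" and \<delta>: "odd \<delta>"
    and X: "0 < cnt s \<delta> X 0" "cnt s \<delta> X 1 = 0" "0 < cnt s \<delta> X 2" "cnt s \<delta> X 3 = 0"
    and A: "0 < cnt u \<delta> A 0" "0 < cnt u \<delta> A 1"
  shows "2 * sz X + 2 * cnt u \<delta> A 0 + 2 * cnt u \<delta> A 1 - 4 \<le> sz (X + A)"
proof -
  let ?y = "cnt s \<delta> X" and ?a = "cnt u \<delta> A" and ?z = "cnt (s + u) \<delta> (X + A)"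
  have tot: "sz (X + A) = ?z 0 + ?z 1 + ?z 2 + ?z 3" "sz X = ?y 0 + ?y 1 + ?y 2 + ?y 3"
    by (rule cnt_total[OF finite_set_plus[OF fin] \<delta>]) (rule cnt_total[OF fin(1) \<delta>])
  have "?y 0 + ?a 0 - 1 \<le> ?z 0" "?y 2 + ?a 0 - 1 \<le> ?z 2" "?y 0 + ?a 1 - 1 \<le> ?z 1" "?y 2 + ?a 1 - 1 \<le> ?z 3"
    using X A by (intro cnt_sumset[OF fin]; simp)+
  with tot X show ?thesis by linarith
qed

text \<open>The middle class of the sum is hit by two pairs; the one that involves the larger class of \<open>A\<close>
is counted.\<close>

lemma two_classes_adjacent:
  assumes fin: "finite X" "finite A" and \<delta>: "odd \<delta>"
    and X: "0 < cnt s \<delta> X 0" "0 < cnt s \<delta> X 1" "cnt s \<delta> X 2 = 0" "cnt s \<delta> X 3 = 0"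
    and A: "0 < cnt u \<delta> A 0" "0 < cnt u \<delta> A 1"
  shows "sz X + cnt u \<delta> A 0 + cnt u \<delta> A 1 + max (cnt u \<delta> A 0) (cnt u \<delta> A 1) - 2 \<le> sz (X + A)"
proof -
  let ?y = "cnt s \<delta> X" and ?a = "cnt u \<delta> A" and ?z = "cnt (s + u) \<delta> (X + A)"
  have tot: "sz (X + A) = ?z 0 + ?z 1 + ?z 2 + ?z 3" "sz X = ?y 0 + ?y 1 + ?y 2 + ?y 3"
    by (rule cnt_total[OF finite_set_plus[OF fin] \<delta>]) (rule cnt_total[OF fin(1) \<delta>])
  have "?y 0 + ?a 0 - 1 \<le> ?z 0" "?y 1 + ?a 0 - 1 \<le> ?z 1" "?y 0 + ?a 1 - 1 \<le> ?z 1" "?y 1 + ?a 1 - 1 \<le> ?z 2"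
    using X A by (intro cnt_sumset[OF fin]; simp)+
  with tot X cnt_nonneg[of "s + u" \<delta> "X + A" 3] show ?thesis by linarith
qed

lemma two_classes_one:
  assumes fin: "finite X" "finite A" and \<delta>: "odd \<delta>"
    and X: "0 < cnt s \<delta> X 0" "cnt s \<delta> X 1 = 0" "cnt s \<delta> X 2 = 0" "cnt s \<delta> X 3 = 0"
    and A: "0 < cnt u \<delta> A 0" "0 < cnt u \<delta> A 1"
  shows "2 * sz X + cnt u \<delta> A 0 + cnt u \<delta> A 1 - 2 \<le> sz (X + A)"
proof -
  let ?y = "cnt s \<delta> X" and ?a = "cnt u \<delta> A" and ?z = "cnt (s + u) \<delta> (X + A)"
  have tot: "sz (X + A) = ?z 0 + ?z 1 + ?z 2 + ?z 3" "sz X = ?y 0 + ?y 1 + ?y 2 + ?y 3"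
    by (rule cnt_total[OF finite_set_plus[OF fin] \<delta>]) (rule cnt_total[OF fin(1) \<delta>])
  have "?y 0 + ?a 0 - 1 \<le> ?z 0" "?y 0 + ?a 1 - 1 \<le> ?z 1"
    using X A by (intro cnt_sumset[OF fin]; simp)+
  with tot X cnt_nonneg[of "s + u" \<delta> "X + A" 2] cnt_nonneg[of "s + u" \<delta> "X + A" 3] show ?thesis by linarith
qed

section \<open>Adding a set that occupies three classes\<close>

lemma Min_sumset:
  fixes A B :: "int set"
  assumes "finite A" "finite B" "A \<noteq> {}" "B \<noteq> {}"
  shows "Min (A + B) = Min A + Min B"
proof (rule Min_eqI)
  show "Min A + Min B \<in> A + B" using assms by (intro set_plus_intro Min_in)
  show "Min A + Min B \<le> y" if "y \<in> A + B" for y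
    using that assms by (auto elim!: set_plus_elim intro!: add_mono Min_le)
qed (use assms in \<open>intro finite_set_plus\<close>)

text \<open>If \<open>D\<close> had only \<open>m\<close> elements, then \<open>B\<close> and \<open>C\<close> would both be equal to \<open>D\<close>.\<close>

lemma sz_gt_of_Min_neq:
  fixes B C D :: "int set"
  assumes "finite D" "B \<subseteq> D" "C \<subseteq> D" "m \<le> sz B" "m \<le> sz C" "Min B \<noteq> Min C"
  shows "m + 1 \<le> sz D"
proof (rule ccontr)
  assume "\<not> m + 1 \<le> sz D"
  then have "card D \<le> card B" "card D \<le> card C" using assms by auto
  then have "B = D" "C = D" using assms card_subset_eq card_mono le_antisym by metis+
  with assms(6) show False by simp
qed

text \<open>Two pairs of classes that hit the same class of \<open>X + A\<close> and guarantee \<open>m\<close> elements each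
guarantee one more as soon as their sums do not start at the same number. Going around
the classes, such coincidences of minima cannot all occur together.\<close>

lemma cnt_sumset_Min_neq:
  assumes fin: "finite X" "finite A"
    and pos: "0 < cnt s \<delta> X i" "0 < cnt t \<delta> A j" "0 < cnt s \<delta> X i'" "0 < cnt t \<delta> A j'"
    and dvd: "4 dvd i + j - k" "4 dvd i' + j' - k"
    and le: "m \<le> cnt s \<delta> X i + cnt t \<delta> A j - 1" "m \<le> cnt s \<delta> X i' + cnt t \<delta> A j' - 1"
    and neq: "Min (cls (s + i * \<delta>) X) + Min (cls (t + j * \<delta>) A)
      \<noteq> Min (cls (s + i' * \<delta>) X) + Min (cls (t + j' * \<delta>) A)"
  shows "m + 1 \<le> cnt (s + t) \<delta> (X + A) k"
proof -
  have "(s + i * \<delta>) + (t + j * \<delta>) - (s + t + k * \<delta>) = (i + j - k) * \<delta>"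
    "(s + i' * \<delta>) + (t + j' * \<delta>) - (s + t + k * \<delta>) = (i' + j' - k) * \<delta>"
    by (simp_all add: algebra_simps)
  with dvd have dvd': "4 dvd (s + i * \<delta>) + (t + j * \<delta>) - (s + t + k * \<delta>)"
    "4 dvd (s + i' * \<delta>) + (t + j' * \<delta>) - (s + t + k * \<delta>)" by simp_all
  note ne = pos[unfolded cnt_pos_iff[OF fin(1)] cnt_pos_iff[OF fin(2)]]
  show ?thesis
    unfolding cnt_def
  proof (rule sz_gt_of_Min_neq[OF _ cls_sumset_subset[OF dvd'(1)] cls_sumset_subset[OF dvd'(2)]])
    show "finite (cls (s + t + k * \<delta>) (X + A))" using fin by (intro finite_cls finite_set_plus)
    show "m \<le> sz (cls (s + i * \<delta>) X + cls (t + j * \<delta>) A)"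
      using sz_sumset[of "cls (s + i * \<delta>) X" "cls (t + j * \<delta>) A"] le(1) ne fin by (simp add: cnt_def)
    show "m \<le> sz (cls (s + i' * \<delta>) X + cls (t + j' * \<delta>) A)"
      using sz_sumset[of "cls (s + i' * \<delta>) X" "cls (t + j' * \<delta>) A"] le(2) ne fin by (simp add: cnt_def)
    show "Min (cls (s + i * \<delta>) X + cls (t + j * \<delta>) A) \<noteq> Min (cls (s + i' * \<delta>) X + cls (t + j' * \<delta>) A)"
      using neq ne fin by (simp add: Min_sumset)
  qed
qed

text \<open>The estimate is linear in the class sizes except for three kinds of ties. If \<open>X\<close> occupies
two opposite classes or three singleton classes, equal minima in the competing sums would
give contradictory equations between the minima of the classes. If \<open>X\<close> occupies all
classes, adding a single class of \<open>A\<close> is enough, up to the at most two elements that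
\<open>sz_sumset_extreme\<close> provides: if all three classes have the same size, one of them contains
neither \<open>Min A\<close> nor \<open>Max A\<close>, and if only two classes are largest, one of these does not
contain \<open>Min A\<close>.\<close>

lemma three_classes:
  assumes fin: "finite X" "finite A" and ne: "X \<noteq> {}"
    and A: "0 < cnt t 1 A 0" "0 < cnt t 1 A 1" "0 < cnt t 1 A 2" "cnt t 1 A 3 = 0"
    and le: "sz X \<le> max (cnt t 1 A 0) (max (cnt t 1 A 1) (cnt t 1 A 2))"
  shows "2 * sz X + sz A - 2 \<le> sz (X + A)"
proof -
  have \<delta>: "odd (1 :: int)" by simp
  let ?a = "cnt t 1 A"
  note z = cnt_sumset[OF fin]
  note nn = cnt_nonneg[of _ 1 "X + A"]
  have finXA: "finite (X + A)" using fin by (rule finite_set_plus)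
  have totA: "sz A = ?a 0 + ?a 1 + ?a 2" using cnt_total[OF fin(2) \<delta>, of t] A by simp
  define P where "P j = cls (t + j * 1) A" for j
  have P: "P j \<noteq> {} \<and> P j \<subseteq> A \<and> finite (P j)" if "0 < ?a j" for j
    using that fin cls_subset unfolding cnt_pos_iff[OF fin(2)] P_def by auto
  have ext: "sz (X + P j) + of_bool (Min A < Min (P j)) + of_bool (Max (P j) < Max A) \<le> sz (X + A)"
    if "0 < ?a j" for j
    using sz_sumset_extreme[OF fin ne, of "P j"] P[OF that] by blast
  have dvd: "4 dvd Min (P j) - (t + j)" "4 dvd Max (P j) - (t + j)" if "0 < ?a j" for j
    using Min_in[of "P j"] Max_in[of "P j"] P[OF that] by (auto simp: P_def cls_def)
  have MinA: "Min A \<le> Min (P j)" and MaxA: "Max (P j) \<le> Max A" if "0 < ?a j" for j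
    using P[OF that] fin by (auto intro!: Min_antimono Max_mono)
  have Min_ne: "Min (P 0) \<noteq> Min (P 1)" "Min (P 0) \<noteq> Min (P 2)" "Min (P 1) \<noteq> Min (P 2)"
    using dvd(1)[OF A(1)] dvd(1)[OF A(2)] dvd(1)[OF A(3)] by presburger+
  have Max_ne: "Max (P 0) \<noteq> Max (P 1)" "Max (P 0) \<noteq> Max (P 2)" "Max (P 1) \<noteq> Max (P 2)"
    using dvd(2)[OF A(1)] dvd(2)[OF A(2)] dvd(2)[OF A(3)] by presburger+
  from fin(1) ne \<delta> show ?thesis
  proof (cases rule: cnt_pattern)
    case (one s)
    let ?y = "cnt s 1 X" and ?z = "cnt (s + t) 1 (X + A)"
    have "?y 0 + ?a 0 - 1 \<le> ?z 0" "?y 0 + ?a 1 - 1 \<le> ?z 1" "?y 0 + ?a 2 - 1 \<le> ?z 2"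
      using one A by (intro z; simp)+
    with totA one cnt_total[OF fin(1) \<delta>, of s] cnt_total[OF finXA \<delta>, of "s + t"] nn[of "s + t" 3]
    show ?thesis by linarith
  next
    case (adjacent s)
    let ?y = "cnt s 1 X" and ?z = "cnt (s + t) 1 (X + A)"
    have "?y 0 + ?a 0 - 1 \<le> ?z 0" "?y 0 + ?a 1 - 1 \<le> ?z 1" "?y 1 + ?a 0 - 1 \<le> ?z 1"
      "?y 0 + ?a 2 - 1 \<le> ?z 2" "?y 1 + ?a 1 - 1 \<le> ?z 2" "?y 1 + ?a 2 - 1 \<le> ?z 3"
      using adjacent A by (intro z; simp)+
    with totA adjacent A le cnt_total[OF fin(1) \<delta>, of s] cnt_total[OF finXA \<delta>, of "s + t"]
    show ?thesis by linarith
  next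
    case (opposite s)
    let ?y = "cnt s 1 X" and ?z = "cnt (s + t) 1 (X + A)"
    have z1: "?y 0 + ?a 0 - 1 \<le> ?z 0" "?y 2 + ?a 2 - 1 \<le> ?z 0" "?y 2 + ?a 0 - 1 \<le> ?z 2"
      "?y 0 + ?a 2 - 1 \<le> ?z 2" "?y 0 + ?a 1 - 1 \<le> ?z 1" "?y 2 + ?a 1 - 1 \<le> ?z 3"
      using opposite A by (intro z; simp)+
    show ?thesis
    proof (cases "?a 0 = ?a 2 \<and> ?a 1 = 1")
      case False
      with z1 totA opposite A cnt_total[OF fin(1) \<delta>, of s] cnt_total[OF finXA \<delta>, of "s + t"]
      show ?thesis by linarith
    next
      case True
      note gain = cnt_sumset_Min_neq[OF fin]
      have "?y 0 + ?a 0 \<le> ?z 0 \<or> ?y 0 + ?a 0 \<le> ?z 2" if eq: "?y 0 = ?y 2"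
      proof -
        have d: "4 dvd (0 :: int) + 0 - 0" "4 dvd (2 :: int) + 2 - 0" "4 dvd (2 :: int) + 0 - 2"
          "4 dvd (0 :: int) + 2 - 2" by simp_all
        have m: "?y 0 + ?a 0 - 1 \<le> ?y 2 + ?a 0 - 1" "?y 0 + ?a 0 - 1 \<le> ?y 0 + ?a 2 - 1"
          "?y 0 + ?a 0 - 1 \<le> ?y 2 + ?a 2 - 1" using True eq by linarith+
        have "?y 0 + ?a 0 - 1 + 1 \<le> ?z 0"
          if "Min (cls (s + 0 * 1) X) + Min (P 0) \<noteq> Min (cls (s + 2 * 1) X) + Min (P 2)"
          by (rule gain[OF opposite(1) A(1) opposite(3) A(3) d(1,2) order_refl m(3) that[unfolded P_def]])
        moreover have "?y 0 + ?a 0 - 1 + 1 \<le> ?z 2"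
          if "Min (cls (s + 2 * 1) X) + Min (P 0) \<noteq> Min (cls (s + 0 * 1) X) + Min (P 2)"
          by (rule gain[OF opposite(3) A(1) opposite(1) A(3) d(3,4) m(1,2) that[unfolded P_def]])
        ultimately show ?thesis using Min_ne by linarith
      qed
      with z1 True totA opposite A cnt_total[OF fin(1) \<delta>, of s] cnt_total[OF finXA \<delta>, of "s + t"]
      show ?thesis by linarith
    qed
  next
    case (three s)
    let ?y = "cnt s 1 X" and ?z = "cnt (s + t) 1 (X + A)"
    have z1: "?y 0 + ?a 0 - 1 \<le> ?z 0" "?y 2 + ?a 2 - 1 \<le> ?z 0" "?y 0 + ?a 1 - 1 \<le> ?z 1"
      "?y 1 + ?a 0 - 1 \<le> ?z 1" "?y 0 + ?a 2 - 1 \<le> ?z 2" "?y 1 + ?a 1 - 1 \<le> ?z 2" "?y 2 + ?a 0 - 1 \<le> ?z 2"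
      "?y 1 + ?a 2 - 1 \<le> ?z 3" "?y 2 + ?a 1 - 1 \<le> ?z 3"
      using three A by (intro z; simp)+
    show ?thesis
    proof (cases "?a 0 = ?a 1 \<and> ?a 1 = ?a 2 \<and> ?y 0 = 1 \<and> ?y 1 = 1 \<and> ?y 2 = 1")
      case False
      (* One class of A is added to all three classes of X, and the remaining class of the sum
         is filled by one of the two other classes of A. *)
      have "sz X + 3 * ?a 0 + ?a 1 + ?y 2 - 4 \<le> sz (X + A)" "sz X + 3 * ?a 0 + ?a 2 + ?y 1 - 4 \<le> sz (X + A)"
        "sz X + 3 * ?a 1 + ?a 0 + ?y 0 - 4 \<le> sz (X + A)" "sz X + 3 * ?a 1 + ?a 2 + ?y 2 - 4 \<le> sz (X + A)"
        "sz X + 3 * ?a 2 + ?a 1 + ?y 0 - 4 \<le> sz (X + A)" "sz X + 3 * ?a 2 + ?a 0 + ?y 1 - 4 \<le> sz (X + A)"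
        using z1 three(4) cnt_total[OF fin(1) \<delta>, of s] cnt_total[OF finXA \<delta>, of "s + t"] by linarith+
      with False three(1-3) le totA show ?thesis by (smt (verit))
    next
      case True
      note gain = cnt_sumset_Min_neq[OF fin]
      have "?a 0 + 1 \<le> ?z 0 \<or> ?a 0 + 1 \<le> ?z 1 \<or> ?a 0 + 1 \<le> ?z 3"
      proof (rule ccontr)
        assume "\<not> ?thesis"
        then have "Min (cls (s + 0 * 1) X) + Min (P 0) = Min (cls (s + 2 * 1) X) + Min (P 2)"
          "Min (cls (s + 0 * 1) X) + Min (P 1) = Min (cls (s + 1 * 1) X) + Min (P 0)"
          "Min (cls (s + 1 * 1) X) + Min (P 2) = Min (cls (s + 2 * 1) X) + Min (P 1)"
          using gain[OF three(1) A(1) three(3) A(3), of 0 "?a 0"]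
            gain[OF three(1) A(2) three(2) A(1), of 1 "?a 0"]
            gain[OF three(2) A(3) three(3) A(2), of 3 "?a 0"] True
          unfolding P_def by simp_all blast+
        then have eq: "Min (cls (s + 0 * 1) X) = Min (cls (s + 2 * 1) X)" by linarith
        have "Min (cls (s + 0 * 1) X) \<in> cls (s + 0 * 1) X" "Min (cls (s + 2 * 1) X) \<in> cls (s + 2 * 1) X"
          using three fin unfolding cnt_pos_iff[OF fin(1)] by (auto intro!: Min_in)
        with eq have "4 dvd Min (cls (s + 0 * 1) X) - s" "4 dvd Min (cls (s + 0 * 1) X) - (s + 2)"
          by (simp_all add: cls_def)
        then show False by presburger
      qed
      moreover have "?a 0 \<le> ?z 0" "?a 0 \<le> ?z 1" "?a 0 \<le> ?z 2" "?a 0 \<le> ?z 3"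
        using z1(1,3,5,8) True by simp_all
      ultimately have "4 * ?a 0 + 1 \<le> sz (X + A)" unfolding cnt_total[OF finXA \<delta>, of "s + t"] by linarith
      moreover have "sz X = 3" using cnt_total[OF fin(1) \<delta>, of s] three(4) True by simp
      moreover have "?a 1 = ?a 0" "?a 2 = ?a 0" using True by simp_all
      ultimately show ?thesis using totA le by simp
    qed
  next
    case all
    have "sz X + 4 * (?a j - 1) \<le> sz (X + P j)" if "0 < ?a j" for j
      using sz_sumset_cls_cnt[OF fin \<delta> that, of 0] all unfolding P_def by simp
    with ext have b: "sz X + 4 * (?a j - 1) + of_bool (Min A < Min (P j)) + of_bool (Max (P j) < Max A)
        \<le> sz (X + A)" if "0 < ?a j" for j
      using that by (smt (verit))
    (* A class of A that another one exceeds on the left, on the right, or on both sides. *)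
    have h0: "sz X + 4 * ?a j - 4 \<le> sz (X + A)" if "0 < ?a j" for j
      using b[OF that] by (auto simp: of_bool_def split: if_splits)
    have h1: "sz X + 4 * ?a j - 3 \<le> sz (X + A)"
      if "0 < ?a j" "0 < ?a i" "Min (P i) < Min (P j)" for i j
      using b[OF that(1)] MinA[OF that(2)] that(3) by (auto simp: of_bool_def split: if_splits)
    have h2: "sz X + 4 * ?a j - 2 \<le> sz (X + A)"
      if "0 < ?a j" "0 < ?a i" "0 < ?a k" "Min (P i) < Min (P j)" "Max (P j) < Max (P k)" for i j k
      using b[OF that(1)] MinA[OF that(2)] MaxA[OF that(3)] that(4,5)
      by (auto simp: of_bool_def split: if_splits)
    have "sz X + 4 * max (?a 0) (max (?a 1) (?a 2)) - 4 \<le> sz (X + A)"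
      using h0[OF A(1)] h0[OF A(2)] h0[OF A(3)] by linarith
    moreover have "sz X + 4 * ?a 0 - 2 \<le> sz (X + A)" if "?a 0 = ?a 1" "?a 0 = ?a 2"
      using that Min_ne Max_ne h2[OF A(1,2,3)] h2[OF A(1,3,2)] h2[OF A(1,2,2)] h2[OF A(1,3,3)]
        h2[OF A(2,1,3)] h2[OF A(2,3,1)] h2[OF A(2,1,1)] h2[OF A(2,3,3)]
        h2[OF A(3,1,2)] h2[OF A(3,2,1)] h2[OF A(3,1,1)] h2[OF A(3,2,2)] by (smt (verit))
    moreover have "sz X + 4 * ?a 0 - 3 \<le> sz (X + A)" if "?a 0 = ?a 1"
      using that Min_ne h1[OF A(1,2)] h1[OF A(2,1)] by linarith
    moreover have "sz X + 4 * ?a 1 - 3 \<le> sz (X + A)" if "?a 1 = ?a 2"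
      using that Min_ne h1[OF A(2,3)] h1[OF A(3,2)] by linarith
    moreover have "sz X + 4 * ?a 0 - 3 \<le> sz (X + A)" if "?a 0 = ?a 2"
      using that Min_ne h1[OF A(1,3)] h1[OF A(3,1)] by linarith
    ultimately show ?thesis using le totA by (smt (verit))
  qed
qed

section \<open>The sum of a set and its dilate, class by class\<close>

abbreviation dsz :: "int set \<Rightarrow> int"
  where "dsz A \<equiv> sz (A + 4 *o A)"

lemma cls_eq_image_quot: "cls r A = (\<lambda>x. 4 * x + r) ` quot r A"
proof
  show "cls r A \<subseteq> (\<lambda>x. 4 * x + r) ` quot r A"
  proof
    fix a assume "a \<in> cls r A"
    then have "a \<in> A" "4 dvd a - r" by (auto simp: cls_def)
    then obtain x where "a = 4 * x + r" by (auto elim!: dvdE simp: algebra_simps)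
    with \<open>a \<in> A\<close> show "a \<in> (\<lambda>x. 4 * x + r) ` quot r A" by (auto simp: quot_def)
  qed
qed (auto simp: cls_def quot_def)

lemma sz_quot: "sz (quot r A) = sz (cls r A)"
  unfolding cls_eq_image_quot by (subst card_image) (auto simp: inj_on_def)

lemma finite_quot: "finite A \<Longrightarrow> finite (quot r A)"
  using finite_cls[of A r] unfolding cls_eq_image_quot by (auto dest: finite_imageD simp: inj_on_def)

lemma quot_empty_iff: "quot r A = {} \<longleftrightarrow> cls r A = {}"
  unfolding cls_eq_image_quot by simp

lemma sz_cls_plus_dilate: "sz (cls r A + 4 *o B) = sz (quot r A + B)"
proof -
  have "cls r A + 4 *o B = (\<lambda>x. 4 * x + r) ` (quot r A + B)"
  proof (intro equalityI subsetI)
    fix z assume "z \<in> cls r A + 4 *o B"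
    then obtain x b where "x \<in> quot r A" "b \<in> B" "z = 4 * x + r + 4 * b"
      unfolding cls_eq_image_quot by (auto elim!: set_plus_elim simp: elt_set_times_def)
    then show "z \<in> (\<lambda>x. 4 * x + r) ` (quot r A + B)"
      by (intro image_eqI[of _ _ "x + b"]) auto
  next
    fix z assume "z \<in> (\<lambda>x. 4 * x + r) ` (quot r A + B)"
    then obtain x b where xb: "x \<in> quot r A" "b \<in> B" "z = 4 * (x + b) + r"
      by (auto elim!: set_plus_elim)
    then have "(4 * x + r) + 4 * b \<in> cls r A + 4 *o B"
      unfolding cls_eq_image_quot by (intro set_plus_intro) (auto simp: elt_set_times_def)
    then show "z \<in> cls r A + 4 *o B" using xb by (simp add: algebra_simps)
  qed
  then show ?thesis by (simp only:) (subst card_image, auto simp: inj_on_def)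
qed

lemma finite_dilate: "finite (A :: int set) \<Longrightarrow> finite (4 *o A)"
  by (simp add: elt_set_times_def)

lemma quot_cls: "quot r (cls r A) = quot r A"
  by (auto simp: quot_def cls_def)

lemma dsz_cls: "dsz (cls r A) = sz (quot r A + cls r A)"
  using sz_cls_plus_dilate[of r "cls r A" "cls r A"] by (simp add: quot_cls cls_cls)

lemma dsz_affine:
  assumes "k \<noteq> 0"
  shows "dsz ((\<lambda>x. k * x + c) ` A) = dsz A"
proof -
  have "(\<lambda>x. k * x + c) ` A + 4 *o ((\<lambda>x. k * x + c) ` A) = (\<lambda>x. k * x + 5 * c) ` (A + 4 *o A)"
    unfolding set_plus_image elt_set_times_def
    by (force simp: algebra_simps image_iff)
  moreover have "inj_on (\<lambda>x. k * x + 5 * c) (A + 4 *o A)" using assms by (auto simp: inj_on_def)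
  ultimately show ?thesis by (simp add: card_image)
qed

lemma dsz_quot: "dsz (quot r A) = dsz (cls r A)"
  unfolding cls_eq_image_quot by (simp add: dsz_affine)

lemma cls_plus_dilate: "cls r (A + 4 *o B) = cls r A + 4 *o B"
proof -
  have "4 dvd a + 4 * b - r \<longleftrightarrow> 4 dvd a - r" for a b :: int by presburger
  then show ?thesis
    by (auto simp: cls_def elt_set_times_def elim!: set_plus_elim intro!: set_plus_intro)
qed

text \<open>The class of \<open>r\<close> in \<open>A + 4 \<cdot> A\<close> is \<open>cls r A + 4 \<cdot> A\<close>, an affine copy of \<open>quot r A + A\<close>.\<close>

lemma dsz_by_classes:
  assumes "finite A" "odd \<delta>"
  shows "dsz A = sz (quot r A + A) + sz (quot (r + \<delta>) A + A) + sz (quot (r + 2 * \<delta>) A + A)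
    + sz (quot (r + 3 * \<delta>) A + A)"
  using sz_by_classes[of "A + 4 *o A" \<delta> r] assms
  by (simp add: finite_set_plus finite_dilate cls_plus_dilate sz_cls_plus_dilate)

lemma cls_sumset_cls: "cls r (X + cls t A) = cls (r - t) X + cls t A"
proof -
  have "4 dvd x + a - r \<longleftrightarrow> 4 dvd x - (r - t)" if "4 dvd a - t" for x a :: int
    using that by presburger
  then show ?thesis
    by (auto simp: cls_def elim!: set_plus_elim intro!: set_plus_intro)
qed

lemma sz_sumset_missing_class:
  assumes fin: "finite X" "finite A" and "cls (r - t) X = {}"
  shows "sz (X + cls t A) + sz (cls r (X + A)) \<le> sz (X + A)"
proof -
  have fXA: "finite (X + A)" using fin by (rule finite_set_plus)
  have sub: "X + cls t A \<subseteq> X + A" using cls_subset by (intro set_plus_mono2) auto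
  have "cls r (X + cls t A) = {}" using assms(3) by (simp add: cls_sumset_cls)
  then have "(X + cls t A) \<inter> cls r (X + A) = {}" by (auto simp: cls_def)
  then have "sz ((X + cls t A) \<union> cls r (X + A)) = sz (X + cls t A) + sz (cls r (X + A))"
    using fXA sub by (subst card_Un_disjoint) (auto intro: finite_subset)
  then show ?thesis
    using sz_mono[OF fXA, of "(X + cls t A) \<union> cls r (X + A)"] sub cls_subset by auto
qed

text \<open>Going around the classes in steps of \<open>\<delta>\<close>, one leaves the classes that \<open>X\<close> occupies at some
point. There \<open>cls (t + \<delta>) A\<close> contributes a class that \<open>X + cls t A\<close> does not meet. This is what
feeds the induction: for \<open>X = quot t A\<close> the first summand is \<open>dsz (cls t A)\<close>.\<close>

lemma sz_sumset_new_class: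
  assumes fin: "finite X" "finite A" and \<delta>: "odd \<delta>" and "X \<noteq> {}" and missing: "cls r0 X = {}"
  shows "sz (X + cls t A) + sz (cls (t + \<delta>) A) \<le> sz (X + A)"
proof -
  from \<open>X \<noteq> {}\<close> \<delta> have "\<exists>s. cls s X \<noteq> {} \<and> cls (s + \<delta>) X = {}"
  proof (cases rule: residue_pattern)
    case (adjacent s)
    then show ?thesis by (intro exI[of _ "s + \<delta>"]) (simp add: algebra_simps)
  next
    case (three s)
    then show ?thesis by (intro exI[of _ "s + 2 * \<delta>"]) (simp add: algebra_simps)
  next
    case all
    then show ?thesis using missing by simp
  qed blast+
  then obtain s where s: "cls s X \<noteq> {}" "cls (s + \<delta>) X = {}" by blast
  have "cls s X + cls (t + \<delta>) A \<subseteq> cls (s + \<delta> + t) (X + A)"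
    by (rule cls_sumset_subset) (simp add: algebra_simps)
  then have "sz (cls s X + cls (t + \<delta>) A) \<le> sz (cls (s + \<delta> + t) (X + A))"
    using fin by (intro sz_mono finite_cls finite_set_plus)
  moreover have "sz (cls (t + \<delta>) A) \<le> sz (cls s X + cls (t + \<delta>) A)"
    using s fin by (intro sz_sumset_ge_right) auto
  ultimately show ?thesis
    using sz_sumset_missing_class[OF fin, of "s + \<delta> + t" t] s by simp
qed

text \<open>The quotient of the class with three elements cannot occupy all four classes, which yields
the first of the five additional elements; the singleton class contributes the other four.\<close>

lemma dsz_three_one:
  assumes fin: "finite A" and \<delta>: "odd \<delta>" and A: "sz (cls u A) = 3" "sz (cls (u + \<delta>) A) = 1" "sz A = 4"
  shows "dsz (cls u A) + 5 \<le> dsz A"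
proof -
  let ?X = "quot u A"
  have X: "finite ?X" "sz ?X = 3" "?X \<noteq> {}" using fin A sz_quot[of u A] finite_quot by auto
  have "\<exists>r. cls r ?X = {}"
  proof (rule ccontr)
    assume "\<not> ?thesis"
    then have "1 \<le> sz (cls r ?X)" for r using X by (intro sz_ge_1) auto
    with sz_by_classes[OF X(1) \<delta>, of 0] X(2) show False by (smt (verit))
  qed
  then have "dsz (cls u A) + 1 \<le> sz (?X + A)"
    using sz_sumset_new_class[OF X(1) fin \<delta> X(3), of _ u] A unfolding dsz_cls by auto
  moreover have "quot (u + \<delta>) A \<noteq> {}" using A fin by (auto simp: quot_empty_iff)
  then have "4 \<le> sz (quot (u + \<delta>) A + A)"
    using sz_sumset_ge_right[of "quot (u + \<delta>) A" A] fin A finite_quot by auto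
  ultimately show ?thesis unfolding dsz_by_classes[OF fin \<delta>, of u] by linarith
qed

text \<open>If the sum of two pairs of integers lies in a translate of a 3-element set \<open>P\<close>, then both pairs
have the same gap \<open>d\<close> and \<open>P\<close> has diameter \<open>2 d\<close>; but a dilated copy of \<open>Y\<close> in \<open>P\<close> has
diameter \<open>4 d\<close>.\<close>

lemma not_subset_translate:
  fixes Y Q P :: "int set"
  assumes "card Y = 2" "card Q = 2" "card P = 3" and sub: "\<And>x. x \<in> Y \<Longrightarrow> 4 * x + u \<in> P"
  shows "\<not> Y + Q \<subseteq> {y} + P"
proof
  let ?E = "{y} + P"
  assume E: "Y + Q \<subseteq> ?E"
  have fin: "finite ?E" "card ?E = 3"
    using assms sz_translate[of y P] card_ge_0_finite[of P] by (auto intro: finite_set_plus)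
  have two: "\<exists>b b'. Z = {b, b'} \<and> b < b'" if "card Z = 2" for Z :: "int set"
    using that unfolding card_2_iff by (metis insert_commute linorder_neq_iff)
  obtain b b' where Y: "Y = {b, b'}" "b < b'" using two assms by blast
  obtain c c' where Q: "Q = {c, c'}" "c < c'" using two assms by blast
  have in_E: "{b + c, b' + c, b' + c'} \<subseteq> ?E" "b + c' \<in> ?E"
    using E Y Q by (auto simp: set_plus_def)
  have "card {b + c, b' + c, b' + c'} = 3" using Y Q by simp
  then have E3: "?E = {b + c, b' + c, b' + c'}"
    using card_subset_eq[OF fin(1) in_E(1)] fin(2) by simp
  with in_E(2) Y Q have "b + c' = b' + c" by auto
  moreover have "y + (4 * b + u) \<in> ?E" "y + (4 * b' + u) \<in> ?E"
    using sub Y by (auto intro!: set_plus_intro)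
  ultimately show False using Y(2) Q(2) unfolding E3 by auto
qed

text \<open>One element more than \<open>sz_sumset_new_class\<close> gives. If the upper class of \<open>X\<close> has at least two
elements, the new class of the sum is larger by one. If it is a singleton, then in the middle
class the sum of the lower class of \<open>X\<close> with \<open>cls (u + \<delta>) A\<close> does not fit into the
translate of \<open>cls u A\<close> that comes from the singleton.\<close>

lemma two_classes_adjacent_gain:
  assumes fin: "finite A" and \<delta>: "odd \<delta>"
    and A: "0 < cnt u \<delta> A 0" "0 < cnt u \<delta> A 1"
  defines "X \<equiv> quot u A"
  assumes X: "0 < cnt s \<delta> X 0" "0 < cnt s \<delta> X 1" "cnt s \<delta> X 2 = 0" "cnt s \<delta> X 3 = 0"
    and big: "2 \<le> cnt s \<delta> X 1 \<or> 3 \<le> cnt u \<delta> A 1 \<or> cnt u \<delta> A 0 = 3 \<and> cnt u \<delta> A 1 = 2"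
  shows "dsz (cls u A) + cnt u \<delta> A 1 + 1 \<le> sz (X + A)"
proof -
  have finX: "finite X" using fin finite_quot by (simp add: X_def)
  let ?P = "cls u A" and ?Q = "cls (u + \<delta>) A"
  let ?y = "cnt s \<delta> X" and ?z = "cnt (s + u) \<delta> (X + A)" and ?w = "cnt (s + u) \<delta> (X + ?P)"
  have finXA: "finite (X + A)" and finXP: "finite (X + ?P)"
    using finX fin by (auto intro!: finite_set_plus)
  have szX: "sz X = cnt u \<delta> A 0" unfolding X_def sz_quot cnt_0 ..
  have w: "?w i = sz (cls (s + i * \<delta>) X + ?P)" for i
    by (simp add: cnt_def cls_sumset_cls algebra_simps)
  have w0: "?w i = 0" if "?y i = 0" for i
    using that finX unfolding w by (simp add: cnt_def)
  have le: "?w i \<le> ?z i" for i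
    unfolding cnt_def
    by (rule sz_mono) (use finXA cls_subset set_plus_mono2[of X X ?P A] in \<open>auto simp: cls_def\<close>)
  have z: "?y 1 + cnt u \<delta> A 1 - 1 \<le> ?z 2" "?y 0 + cnt u \<delta> A 1 - 1 \<le> ?z 1"
    using X A by (intro cnt_sumset[OF finX fin]; simp)+
  have tot: "dsz ?P = ?w 0 + ?w 1" "sz (X + A) = ?z 0 + ?z 1 + ?z 2 + ?z 3" "sz X = ?y 0 + ?y 1"
    using cnt_total[OF finXP \<delta>, of "s + u"] cnt_total[OF finXA \<delta>, of "s + u"]
      cnt_total[OF finX \<delta>, of s] w0[of 2] w0[of 3] X unfolding dsz_cls X_def by simp_all
  show ?thesis
  proof (cases "2 \<le> ?y 1")
    case True
    with tot z le[of 0] le[of 1] cnt_nonneg[of "s + u" \<delta> "X + A" 3] show ?thesis by linarith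
  next
    case False
    then have y1: "?y 1 = 1" using X(2) by linarith
    then obtain y where Y1: "cls (s + 1 * \<delta>) X = {y}" by (auto simp: cnt_def card_1_singleton_iff)
    have w1: "?w 1 = cnt u \<delta> A 0" unfolding w Y1 sz_translate cnt_0 ..
    have "?w 1 + 1 \<le> ?z 1"
    proof (cases "3 \<le> cnt u \<delta> A 1")
      case True
      with z(2) w1 tot(3) szX y1 show ?thesis by linarith
    next
      case False
      with big y1 have pq: "cnt u \<delta> A 0 = 3" "cnt u \<delta> A 1 = 2" by auto
      have "\<not> cls s X + ?Q \<subseteq> {y} + ?P"
      proof (rule not_subset_translate)
        show "card ?Q = 2" "card ?P = 3" using pq by (auto simp: cnt_def)
        show "card (cls s X) = 2" using tot(3) szX y1 pq by (simp add: cnt_0)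
        show "4 * x + u \<in> ?P" if "x \<in> cls s X" for x
          using that by (auto simp: X_def cls_def quot_def)
      qed
      moreover have "cls s X + ?Q \<subseteq> cls (s + u + 1 * \<delta>) (X + A)"
        by (rule cls_sumset_subset) (simp add: algebra_simps)
      moreover have "{y} + ?P \<subseteq> cls (s + u + 1 * \<delta>) (X + A)"
        unfolding Y1[symmetric] by (rule cls_sumset_subset) (simp add: algebra_simps)
      ultimately have "{y} + ?P \<subset> cls (s + u + 1 * \<delta>) (X + A)" by blast
      then have "card ({y} + ?P) < card (cls (s + u + 1 * \<delta>) (X + A))"
        using finXA by (intro psubset_card_mono) auto
      then show ?thesis unfolding w Y1 by (simp add: cnt_def)
    qed
    with tot z le[of 0] y1 cnt_nonneg[of "s + u" \<delta> "X + A" 3] show ?thesis by linarith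
  qed
qed

text \<open>What is known about \<open>N = |X + A|\<close> when \<open>A\<close> consists of a class of size \<open>p\<close> with quotient \<open>X\<close> and
another class of size \<open>q\<close>, and \<open>F\<close> is the size of the sum of the first class and its dilate.
The alternatives correspond to \<open>X\<close> occupying at least three classes, two opposite classes, a
single class, and two adjacent classes.\<close>

definition part_bound :: "int \<Rightarrow> int \<Rightarrow> int \<Rightarrow> int \<Rightarrow> bool" where
  "part_bound p q N F \<longleftrightarrow>
    3 \<le> p \<and> p + 3 * max p q + min p q - 3 \<le> N \<or>
    2 \<le> p \<and> 4 * p + 2 * q - 4 \<le> N \<or>
    F + p + q - 1 \<le> N \<and> 3 * p + q - 2 \<le> N \<or>
    2 \<le> p \<and> F + q \<le> N \<and> 2 * p + q + max p q - 2 \<le> N \<and>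
      (3 \<le> q \<or> p = 3 \<and> q = 2 \<longrightarrow> F + q + 1 \<le> N) \<and> (p = 4 \<longrightarrow> F + q + 1 \<le> N \<or> 13 \<le> F)"

text \<open>The alternative \<open>13 \<le> F\<close> for \<open>p = 4\<close> comes from a quotient that splits into adjacent classes
of 3 elements and 1 element: there \<open>dsz_three_one\<close> reduces \<open>F\<close> to a set with 3 elements,
for which the bound 8 enters as a hypothesis.\<close>

lemma two_classes_part_bound:
  assumes fin: "finite A" and \<delta>: "odd \<delta>"
    and A: "0 < cnt u \<delta> A 0" "0 < cnt u \<delta> A 1"
    and three: "\<And>B. cnt u \<delta> A 0 = 4 \<Longrightarrow> finite B \<Longrightarrow> sz B = 3 \<Longrightarrow> 8 \<le> dsz B"
  shows "part_bound (cnt u \<delta> A 0) (cnt u \<delta> A 1) (sz (quot u A + A)) (dsz (cls u A))"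
proof -
  define X where "X = quot u A"
  have finX: "finite X" using fin finite_quot by (simp add: X_def)
  have szX: "sz X = cnt u \<delta> A 0" unfolding X_def sz_quot cnt_0 ..
  have ne: "X \<noteq> {}" using A(1) szX by auto
  note nn = cnt_nonneg[of _ \<delta> X]
  note total = cnt_total[OF finX \<delta>]
  note F = dsz_cls[of u A, folded X_def]
  from finX ne \<delta> have "part_bound (cnt u \<delta> A 0) (cnt u \<delta> A 1) (sz (X + A)) (dsz (cls u A))"
  proof (cases rule: cnt_pattern)
    case (one s)
    let ?z = "cnt (s + u) \<delta> (X + A)"
    have "cnt s \<delta> X 0 + cnt u \<delta> A 1 - 1 \<le> ?z 1"
      using one A by (intro cnt_sumset[OF finX fin]) simp_all
    moreover have "cls (s + u + 1 * \<delta> - u) X = {}"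
      using one(2) finX by (simp add: cnt_def)
    from sz_sumset_missing_class[OF finX fin this]
    have "dsz (cls u A) + ?z 1 \<le> sz (X + A)" unfolding F cnt_def .
    ultimately show ?thesis
      using two_classes_one[OF finX fin \<delta> one A] total[of s] one szX unfolding part_bound_def by linarith
  next
    case (adjacent s)
    have "cls (s + 2 * \<delta>) X = {}" using adjacent(3) finX by (simp add: cnt_def)
    from sz_sumset_new_class[OF finX fin \<delta> ne this, of u]
    have 1: "dsz (cls u A) + cnt u \<delta> A 1 \<le> sz (X + A)" by (simp add: F cnt_def)
    note 2 = two_classes_adjacent[OF finX fin \<delta> adjacent A]
    note 3 = two_classes_adjacent_gain[OF fin \<delta> A, folded X_def, OF adjacent]
    have 4: "13 \<le> dsz (cls u A)" if p: "cnt u \<delta> A 0 = 4" and y: "\<not> 2 \<le> cnt s \<delta> X 1"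
    proof -
      have y1: "cnt s \<delta> X 1 = 1" and y0: "cnt s \<delta> X 0 = 3"
        using y p adjacent total[of s] szX by linarith+
      have "sz (cls s X) = 3" using y0 by (simp add: cnt_0)
      moreover have "sz (cls (s + \<delta>) X) = 1" using y1 by (simp add: cnt_def)
      ultimately have "dsz (cls s X) + 5 \<le> dsz X"
        using szX p by (intro dsz_three_one[OF finX \<delta>]) auto
      moreover have "8 \<le> dsz (cls s X)"
        using \<open>sz (cls s X) = 3\<close> finX by (intro three p) auto
      ultimately show ?thesis by (simp add: X_def dsz_quot)
    qed
    have "2 \<le> cnt u \<delta> A 0" using adjacent total[of s] szX by linarith
    with 1 2 3 4 szX show ?thesis unfolding part_bound_def by (smt (verit))
  next
    case (opposite s)
    have "2 \<le> cnt u \<delta> A 0" using opposite total[of s] szX by linarith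
    with two_classes_opposite[OF finX fin \<delta> opposite A] szX show ?thesis
      unfolding part_bound_def by linarith
  next
    case (three s)
    have "3 \<le> cnt u \<delta> A 0" using three total[of s] szX by linarith
    with two_classes_spread[OF finX fin \<delta> three(1-3) A] szX show ?thesis
      unfolding part_bound_def by linarith
  next
    case all
    have "3 \<le> cnt u \<delta> A 0"
      using total[of 0] all[of 0 0] all[of 0 1] all[of 0 2] all[of 0 3] szX by linarith
    with two_classes_spread[OF finX fin \<delta> all[of 0] all[of 0] all[of 0] A] szX show ?thesis
      unfolding part_bound_def by linarith
  qed
  then show ?thesis by (simp add: X_def)
qed

text \<open>Sets with 3 or 4 elements can violate the bound \<open>5 n - 6\<close>: \<open>{0, 1, 4}\<close> gives 8 and
\<open>{0, 1, 4, 5}\<close> gives 12. The induction passes through such sets, so their true minima are part of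
its statement.\<close>

definition dsz_bound :: "int \<Rightarrow> int"
  where "dsz_bound n = (if n = 1 then 1 else if n = 3 then 8 else if n = 4 then 12 else 5 * n - 6)"

text \<open>Which alternative applies to one class is independent of the other class, so every combination has
to satisfy the bound. For large \<open>p\<close> and \<open>q\<close> there is room to spare wherever the
induction hypothesis enters; the additional elements collected in \<open>part_bound\<close>
are needed when \<open>p\<close> or \<open>q\<close> is at most 4.\<close>

lemma part_bounds_combine:
  assumes "part_bound p q N1 F1" "part_bound q p N2 F2" "1 \<le> p" "1 \<le> q"
    "dsz_bound p \<le> F1" "dsz_bound q \<le> F2"
  shows "dsz_bound (p + q) \<le> N1 + N2"
proof -
  have *: "dsz_bound (p + q) \<le> N1 + N2"
    if "part_bound p q N1 F1" "part_bound q p N2 F2" "1 \<le> p" "p \<le> q"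
    "dsz_bound p \<le> F1" "dsz_bound q \<le> F2" for p q N1 N2 F1 F2
  proof -
    have mm: "max p q = q" "max q p = q" "min p q = p" "min q p = p" using that by auto
    have B: "n = 1 \<and> dsz_bound n = 1 \<or> n = 2 \<and> dsz_bound n = 4 \<or> n = 3 \<and> dsz_bound n = 8
       \<or> n = 4 \<and> dsz_bound n = 12 \<or> 5 \<le> n \<and> dsz_bound n = 5 * n - 6" if "1 \<le> n" for n
      using that by (auto simp: dsz_bound_def)
    have S: "dsz_bound (p + q) \<le> 5 * (p + q) - 6" "p + q = 3 \<Longrightarrow> dsz_bound (p + q) \<le> 8"
      "p + q = 4 \<Longrightarrow> dsz_bound (p + q) \<le> 12"
      using that by (auto simp: dsz_bound_def)
    show ?thesis
      using that B[of p] B[of q] S unfolding part_bound_def mm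
      by (smt (verit))
  qed
  show ?thesis
  proof (cases "p \<le> q")
    case False
    with *[of q p N2 F2 N1 F1] assms show ?thesis by (simp add: add.commute)
  qed (use * assms in blast)
qed

section \<open>Induction on the cardinality\<close>

lemma dsz_two_classes:
  assumes fin: "finite A" and \<delta>: "odd \<delta>"
    and A: "0 < cnt u \<delta> A 0" "0 < cnt u \<delta> A 1" "cnt u \<delta> A 2 = 0" "cnt u \<delta> A 3 = 0"
    and IH: "\<And>B. finite B \<Longrightarrow> B \<noteq> {} \<Longrightarrow> sz B < sz A \<Longrightarrow> dsz_bound (sz B) \<le> dsz B"
  shows "dsz_bound (sz A) \<le> dsz A"
proof -
  let ?p = "cnt u \<delta> A 0" and ?q = "cnt u \<delta> A 1"
  have n: "sz A = ?p + ?q" using cnt_total[OF fin \<delta>, of u] A by linarith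
  have three: "8 \<le> dsz B" if "finite B" "sz B = 3" "4 \<le> sz A" for B
    proof -
    have "B \<noteq> {}" using that by auto
    with IH[of B] that show ?thesis by (simp add: dsz_bound_def)
  qed
  (* The roles of the two classes are exchanged by starting from u + \<delta> in the opposite direction. *)
  have swap: "cnt (u + \<delta>) (- \<delta>) A 0 = ?q" "cnt (u + \<delta>) (- \<delta>) A 1 = ?p"
    by (simp_all add: cnt_def)
  have P: "part_bound ?p ?q (sz (quot u A + A)) (dsz (cls u A))"
    using A n by (intro two_classes_part_bound[OF fin \<delta>] three) auto
  have Q: "part_bound ?q ?p (sz (quot (u + \<delta>) A + A)) (dsz (cls (u + \<delta>) A))"
    unfolding swap[symmetric]
  proof (rule two_classes_part_bound[OF fin])
    show "8 \<le> dsz B" if "cnt (u + \<delta>) (- \<delta>) A 0 = 4" "finite B" "sz B = 3" for B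
      using that A n unfolding swap by (intro three) auto
  qed (use \<delta> A swap in auto)
  have "cls u A \<noteq> {}" "cls (u + \<delta>) A \<noteq> {}" using A by (auto simp: cnt_def)
  then have "dsz_bound ?p \<le> dsz (cls u A)" "dsz_bound ?q \<le> dsz (cls (u + \<delta>) A)"
    using IH[of "cls u A"] IH[of "cls (u + \<delta>) A"] A fin n by (auto simp: cnt_def)
  with P Q A have "dsz_bound (?p + ?q) \<le> sz (quot u A + A) + sz (quot (u + \<delta>) A + A)"
    by (intro part_bounds_combine) auto
  with n dsz_by_classes[OF fin \<delta>, of u] show ?thesis by simp
qed

text \<open>Summing \<open>three_classes\<close> over the three quotients gives \<open>2 n + 3 (n - 2)\<close>. Equality holds
for \<open>{0, 1, 2, 4, 5, 6}\<close>.\<close>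

lemma dsz_three_classes:
  assumes fin: "finite A"
    and A: "0 < cnt t 1 A 0" "0 < cnt t 1 A 1" "0 < cnt t 1 A 2" "cnt t 1 A 3 = 0"
  shows "5 * sz A - 6 \<le> dsz A"
proof -
  have \<delta>: "odd (1 :: int)" by simp
  have *: "2 * cnt t 1 A j + sz A - 2 \<le> sz (quot (t + j * 1) A + A)" if "j \<in> {0, 1, 2}" for j
  proof -
    have j: "sz (quot (t + j * 1) A) = cnt t 1 A j" by (simp add: cnt_def sz_quot)
    have "0 < cnt t 1 A j" using that A by auto
    then have "quot (t + j * 1) A \<noteq> {}" using j by auto
    moreover have "cnt t 1 A j \<le> max (cnt t 1 A 0) (max (cnt t 1 A 1) (cnt t 1 A 2))"
      using that by auto
    ultimately show ?thesis
      using three_classes[OF finite_quot[OF fin] fin _ A, of "t + j * 1"] unfolding j by blast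
  qed
  show ?thesis
    using *[of 0] *[of 1] *[of 2] cnt_total[OF fin \<delta>, of t] A(4) dsz_by_classes[OF fin \<delta>, of t]
    by simp
qed

lemma dsz_four_classes:
  assumes fin: "finite A" and A: "\<And>r. cls r A \<noteq> {}"
  shows "5 * sz A - 4 \<le> dsz A"
proof -
  have \<delta>: "odd (1 :: int)" by simp
  have "A \<noteq> {}" using A by (auto simp: cls_def)
  then have *: "sz (cls r A) + sz A - 1 \<le> sz (quot r A + A)" for r
    using sz_sumset[OF finite_quot[OF fin] fin, of r] A by (simp add: sz_quot quot_empty_iff)
  show ?thesis
    using *[of 0] *[of 1] *[of 2] *[of 3] sz_by_classes[OF fin \<delta>, of 0] dsz_by_classes[OF fin \<delta>, of 0]
    by simp
qed

text \<open>Replacing \<open>A\<close> by \<open>(A - Min A) / 2\<close> while all differences are even shortens \<open>A\<close>.\<close>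

lemma ex_both_parities:
  assumes "finite A" "2 \<le> card A"
  shows "\<exists>A'. finite A' \<and> card A' = card A \<and> dsz A' = dsz A \<and> (\<exists>a \<in> A'. \<exists>b \<in> A'. odd (a - b))"
  using assms
proof (induction "nat (Max A - Min A)" arbitrary: A rule: less_induct)
  case less
  show ?case
  proof (cases "\<exists>a \<in> A. \<exists>b \<in> A. odd (a - b)")
    case True
    with less show ?thesis by blast
  next
    case False
    have ne: "A \<noteq> {}" using less.prems by auto
    have m: "Min A \<in> A" using less.prems ne by auto
    let ?h = "\<lambda>a. (a - Min A) div 2"
    define A' where "A' = ?h ` A"
    have double: "2 * ?h a + Min A = a" if "a \<in> A" for a
    proof -
      have "even (a - Min A)" using False that m by blast
      then show ?thesis by simp
    qed
    have "(\<lambda>x. 2 * x + Min A) ` A' = (\<lambda>a. a) ` A"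
      unfolding A'_def image_image using double by (rule image_cong[OF refl])
    then have A: "A = (\<lambda>x. 2 * x + Min A) ` A'" by simp
    have fin': "finite A'" using less.prems by (simp add: A'_def)
    have inj: "inj_on ?h A" by (rule inj_on_inverseI[where g = "\<lambda>x. 2 * x + Min A"]) (rule double)
    have card': "card A' = card A" unfolding A'_def using inj by (rule card_image)
    have dsz': "dsz A' = dsz A" using dsz_affine[of 2 "Min A" A'] unfolding A[symmetric] by simp
    have "Max A' \<in> A'" "Min A' \<in> A'" using fin' ne by (auto simp: A'_def)
    then obtain M m' where M: "M \<in> A" "Max A' = ?h M" and m': "m' \<in> A" "Min A' = ?h m'"
      unfolding A'_def by auto
    have "Min A < Max A"
    proof (rule ccontr)
      assume "\<not> Min A < Max A"
      have "x = Min A" if "x \<in> A" for x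
        using that \<open>\<not> Min A < Max A\<close> Max_ge[OF less.prems(1) that] Min_le[OF less.prems(1) that] by linarith
      then have "A \<subseteq> {Min A}" by blast
      then have "card A \<le> card {Min A}" by (intro card_mono) auto
      then show False using less.prems by simp
    qed
    moreover have "M \<le> Max A" "Min A \<le> m'" using M m' less.prems by auto
    moreover have "2 * Max A' - 2 * Min A' = M - m'" using double[OF M(1)] double[OF m'(1)] M m' by simp
    ultimately have "Max A' - Min A' < Max A - Min A" "0 < Max A - Min A" by linarith+
    then have "nat (Max A' - Min A') < nat (Max A - Min A)" by simp
    from less.hyps[OF this fin'] less.prems card' dsz' show ?thesis by simp
  qed
qed

text \<open>A set that contains both parities occupies neither a single class nor just two opposite ones,
which leaves the three cases treated above.\<close>

lemma dsz_bound_le_dsz: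
  assumes "finite A" "A \<noteq> {}"
  shows "dsz_bound (sz A) \<le> dsz A"
  using assms
proof (induction "card A" arbitrary: A rule: less_induct)
  case less
  have \<delta>: "odd (1 :: int)" by simp
  have pos: "0 < card A" using less.prems by (simp add: card_gt_0_iff)
  show ?case
  proof (cases "card A = 1")
    case True
    then have "dsz_bound (sz A) = 1" by (simp add: dsz_bound_def)
    moreover have "1 \<le> dsz A"
      using less.prems finite_dilate[of A]
      by (intro sz_ge_1 finite_set_plus) (auto simp: set_plus_def elt_set_times_def)
    ultimately show ?thesis by simp
  next
    case False
    with pos have "2 \<le> card A" by linarith
    then obtain A' a b where A': "finite A'" "card A' = card A" "dsz A' = dsz A"
      and ab: "a \<in> A'" "b \<in> A'" "odd (a - b)"
      using ex_both_parities[OF less.prems(1)] by blast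
    have IH: "dsz_bound (sz B) \<le> dsz B" if "finite B" "B \<noteq> {}" "sz B < sz A'" for B
      using less.hyps[of B] that A'(2) by simp
    have n: "dsz_bound (sz A') \<le> 5 * sz A' - 6" if "2 \<le> sz A'"
      using that by (auto simp: dsz_bound_def)
    have "2 \<le> sz A'" using \<open>2 \<le> card A\<close> A' by simp
    note n = n[OF this]
    have "A' \<noteq> {}" using ab by auto
    have covers: "\<exists>i \<in> {0, 1, 2, 3}. x \<in> cls (s + i * 1) A'" if "x \<in> A'" for s x
    proof -
      have "\<exists>i \<in> {0, 1, 2, 3}. 4 dvd x - (s + i)" by simp presburger
      with that show ?thesis by (auto simp: cls_def)
    qed
    have even: "\<not> (cnt s 1 A' 1 = 0 \<and> cnt s 1 A' 3 = 0)" for s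
    proof
      assume "cnt s 1 A' 1 = 0 \<and> cnt s 1 A' 3 = 0"
      then have e: "cls (s + 1) A' = {}" "cls (s + 3) A' = {}" using A' by (auto simp: cnt_def)
      have "even (x - s)" if "x \<in> A'" for x
      proof -
        from covers[OF that, of s] e have "4 dvd x - s \<or> 4 dvd x - (s + 2)" by (auto simp: cls_def)
        then show ?thesis by presburger
      qed
      from this[OF ab(1)] this[OF ab(2)] ab(3) show False by presburger
    qed
    from A'(1) \<open>A' \<noteq> {}\<close> \<delta> have "dsz_bound (sz A') \<le> dsz A'"
    proof (cases rule: cnt_pattern)
      case (one s)
      with even[of s] show ?thesis by simp
    next
      case (adjacent s)
      then show ?thesis using IH by (intro dsz_two_classes[OF A'(1) \<delta>]) auto
    next
      case (opposite s)
      with even[of s] show ?thesis by simp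
    next
      case (three s)
      with n dsz_three_classes[OF A'(1)] show ?thesis by fastforce
    next
      case all
      have "cls r A' \<noteq> {}" for r using all[of r 0] A'(1) by (simp add: cnt_pos_iff)
      with n dsz_four_classes[OF A'(1)] show ?thesis by fastforce
    qed
    with A' show ?thesis by simp
  qed
qed

theorem theorem3:
  fixes A :: "int set"
  assumes "finite A" and "card A \<ge> 5"
  shows "int (card (A + 4 *o A)) \<ge> 5 * int (card A) - 6"
proof -
  have "A \<noteq> {}" using assms by auto
  with assms dsz_bound_le_dsz[of A] show ?thesis by (simp add: dsz_bound_def)
qed

end
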